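(* Let $k$ be a positive real number. The $k$-binomial transform $(w_{k,n})_{n\ge 0}$ of the modified $k$-Fibonacci-like sequence satisfies the recurrence relation $$w_{k,n+1} = k(k+2)\,w_{k,n} - k^{3}\, w_{k,n-1}\quad\text{for all integers } n\ge 1,$$ with the initial conditions $w_{k,0}=2$ and $w_{k,1}=4k$.
   Context: For a positive real number $k$, the modified $k$-Fibonacci-like sequence $(M_{k,n})_{n\ge 0}$ is defined by $M_{k,0}=M_{k,1}=2$ and $M_{k,n+1}=kM_{k,n}+M_{k,n-1}$ for $n\ge 1$. Its $k$-binomial transform $(w_{k,n})_{n\ge 0}$ is defined by $w_{k,n}=\sum_{i=0}^{n}\binom{n}{i}k^{n}M_{k,i}$. *)

theory Defs
  imports Complex_Main
begin

fun mod_fib_like :: "real \<Rightarrow> nat \<Rightarrow> real" where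
  "mod_fib_like k 0 = 2"
| "mod_fib_like k (Suc 0) = 2"
| "mod_fib_like k (Suc (Suc n)) = k * mod_fib_like k (Suc n) + mod_fib_like k n"

definition k_binomial_transform :: "real \<Rightarrow> (nat \<Rightarrow> real) \<Rightarrow> nat \<Rightarrow> real" where
  "k_binomial_transform k a n = (\<Sum>i=0..n. real (n choose i) * k ^ n * a i)"

definition w :: "real \<Rightarrow> nat \<Rightarrow> real" where
  "w k n = k_binomial_transform k (mod_fib_like k) n"

end

theory Submission
  imports Defs
begin

text \<open>
  Pascal's rule says that the binomial transform turns the operator \<open>1 + E\<close>, with \<open>E\<close> the shift
  of the argument sequence, into the shift of the transformed sequence; the weight \<open>k ^ n\<close>
  contributes a further factor \<open>k\<close> (lemma \<open>k_binomial_transform_Suc\<close>). The sequence \<open>M\<close> satisfies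
  \<open>E\<^sup>2 M = k E M + M\<close>. Hence the transform \<open>w\<close> of \<open>M\<close> and the transform \<open>v\<close> of \<open>E M\<close> form the
  first-order system \<open>w (n + 1) = k (w n + v n)\<close>, \<open>v (n + 1) = k (w n + (k + 1) v n)\<close>. Its matrix
  has trace \<open>k (k + 2)\<close> and determinant \<open>k\<^sup>2 (k + 1) - k\<^sup>2 = k\<^sup>3\<close>, which by Cayley-Hamilton are the
  coefficients of the recurrence; the proof eliminates \<open>v\<close> by hand.
\<close>

lemma k_binomial_transform_Suc:
  "k_binomial_transform k a (Suc n) =
     k * (k_binomial_transform k a n + k_binomial_transform k (\<lambda>i. a (Suc i)) n)"
proof -
  have "(\<Sum>i\<le>Suc n. real (Suc n choose i) * a i)
      = a 0 + (\<Sum>i\<le>n. real (n choose Suc i) * a (Suc i)) + (\<Sum>i\<le>n. real (n choose i) * a (Suc i))"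
    by (simp add: sum.atMost_Suc_shift distrib_right sum.distrib del: sum.atMost_Suc)
  also have "a 0 + (\<Sum>i\<le>n. real (n choose Suc i) * a (Suc i))
      = (\<Sum>i\<le>Suc n. real (n choose i) * a i)"
    by (simp add: sum.atMost_Suc_shift del: sum.atMost_Suc)
  \<comment> \<open>The top term drops out, since \<open>n choose Suc n = 0\<close>.\<close>
  also have "\<dots> = (\<Sum>i\<le>n. real (n choose i) * a i)"
    by simp
  finally have pascal: "(\<Sum>i\<le>Suc n. real (Suc n choose i) * a i)
      = (\<Sum>i\<le>n. real (n choose i) * a i) + (\<Sum>i\<le>n. real (n choose i) * a (Suc i))" .
  have factor: "k_binomial_transform k b m = k ^ m * (\<Sum>i\<le>m. real (m choose i) * b i)" for b m
    by (simp add: k_binomial_transform_def sum_distrib_left atMost_atLeast0 mult_ac)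
  show ?thesis
    unfolding factor pascal by (simp add: algebra_simps)
qed

lemma k_binomial_transform_linear:
  "k_binomial_transform k (\<lambda>i. c * a i + b i) n =
     c * k_binomial_transform k a n + k_binomial_transform k b n"
  by (simp add: k_binomial_transform_def sum_distrib_left sum.distrib algebra_simps)

lemma w_Suc_Suc: "w k (Suc (Suc n)) = k * (k + 2) * w k (Suc n) - k ^ 3 * w k n"
proof -
  define v where "v = k_binomial_transform k (\<lambda>i. mod_fib_like k (Suc i))"
  have w_Suc: "w k (Suc m) = k * (w k m + v m)" for m
    by (simp add: w_def v_def k_binomial_transform_Suc)
  have v_Suc: "v (Suc n) = k * (v n + (k * v n + w k n))"
    by (simp add: w_def v_def k_binomial_transform_Suc k_binomial_transform_linear)
  show ?thesis
    unfolding w_Suc v_Suc by (simp add: algebra_simps power3_eq_cube)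
qed

theorem theorem6:
  fixes k :: real
  assumes "k > 0"
  shows "(\<forall>n::nat. n \<ge> 1 \<longrightarrow> w k (n + 1) = k * (k + 2) * w k n - k ^ 3 * w k (n - 1))
         \<and> w k 0 = 2 \<and> w k 1 = 4 * k"
proof (intro conjI allI impI)
  fix n :: nat
  assume "n \<ge> 1"
  then obtain m where "n = Suc m"
    by (cases n) auto
  then show "w k (n + 1) = k * (k + 2) * w k n - k ^ 3 * w k (n - 1)"
    by (simp add: w_Suc_Suc)
qed (simp_all add: w_def k_binomial_transform_def)

end
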